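(* For $k\ge1$ let $a_k$ be the lexicographically least periodic sequence in $\Gamma$ whose smallest period is $k$. Write $k=2^n(2m+1)$ with integers $n,m\ge0$. Then $$ a_k=\begin{cases} \mathfrak m_1^{\infty} & \text{if } m=n=0 \text{ (i.e. } k=1),\\ (\mathfrak m_1\mathfrak m_2\mathfrak m_3\cdots\mathfrak m_{2^n-1}\,\overline{\mathfrak m_{2^n}})^{\infty} & \text{if } m=0 \text{ and } n\ge1,\\ \bigl(\mathfrak m_1\mathfrak m_2\mathfrak m_3\cdots\mathfrak m_{3\cdot2^n}\,(\mathfrak m_1\cdots\mathfrak m_{2^{n+1}-1}\,\overline{\mathfrak m_{2^{n+1}}})^{m-1}\bigr)^{\infty} & \text{if } m\ge1. \end{cases} $$
   Context: Let $\Sigma=\{0,1\}^{\mathbb N}$ (sequences indexed from $1$), let $\sigma$ be the shift $(\sigma\varepsilon)_i=\varepsilon_{i+1}$, and let $\overline{\varepsilon}$ be the mirror image, $\overline{\varepsilon}_i=1-\varepsilon_i$ (likewise for letters and finite words). $\preceq$ is the lexicographic order on $\Sigma$. Put $$\Gamma=\{\varepsilon\in\Sigma:\ \overline\varepsilon\preceq\sigma^k\varepsilon\preceq\varepsilon\ \text{ for all } k\ge0\}.$$ $(\mathfrak m_k)_{k\ge0}=0110\,1001\ldots$ is the Thue-Morse sequence, i.e. the fixed point starting with $0$ of the morphism $0\mapsto01$, $1\mapsto10$. For a finite word $w$, $w^{j}$ denotes the $j$-fold concatenation ($w^0$ is empty) and $w^\infty$ the infinite concatenation $www\cdots$. "Periodic"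 means purely periodic. *)

theory Defs
  imports "HOL-Library.Fun_Lexorder"
begin

text \<open>
  The letters 0 and 1 are \<^term>\<open>False\<close> and \<^term>\<open>True\<close>, so that the library order on
  \<^typ>\<open>bool\<close> is the order of the letters and negation is the mirror image. A sequence
  indexed from 1 is stored with its first letter at position \<^term>\<open>0::nat\<close>: the \<open>i\<close>-th letter
  of \<open>e\<close> is \<open>e (i - 1)\<close>.
\<close>

type_synonym letter = bool
type_synonym seq = "nat \<Rightarrow> letter"

definition shift :: "seq \<Rightarrow> seq" where
  "shift e = (\<lambda>i. e (Suc i))"

definition mirror :: "seq \<Rightarrow> seq" where
  "mirror e = (\<lambda>i. \<not> e i)"

definition lex_le :: "seq \<Rightarrow> seq \<Rightarrow> bool" (infix "\<preceq>" 50) where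
  "d \<preceq> e \<longleftrightarrow> less_fun d e \<or> d = e"

definition Gamma :: "seq set" where
  "Gamma = {e. \<forall>k. mirror e \<preceq> (shift ^^ k) e \<and> (shift ^^ k) e \<preceq> e}"

definition has_period :: "nat \<Rightarrow> seq \<Rightarrow> bool" where
  "has_period p e \<longleftrightarrow> p \<ge> 1 \<and> (shift ^^ p) e = e"

definition smallest_period :: "nat \<Rightarrow> seq \<Rightarrow> bool" where
  "smallest_period p e \<longleftrightarrow> has_period p e \<and> (\<forall>q. has_period q e \<longrightarrow> p \<le> q)"

definition is_least_periodic :: "nat \<Rightarrow> seq \<Rightarrow> bool" where
  "is_least_periodic k e \<longleftrightarrow>
     e \<in> Gamma \<and> smallest_period k e \<and> (\<forall>d \<in> Gamma. smallest_period k d \<longrightarrow> e \<preceq> d)"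

definition a_seq :: "nat \<Rightarrow> seq" where
  "a_seq k = (THE e. is_least_periodic k e)"

fun tm_letter :: "letter \<Rightarrow> letter list" where
  "tm_letter False = [False, True]"
| "tm_letter True = [True, False]"

text \<open>
  The morphism has constant length 2, so letter number \<open>i\<close> of the image lies in the block
  that comes from letter number \<open>i div 2\<close> of the argument.
\<close>

definition tm_morphism :: "seq \<Rightarrow> seq" where
  "tm_morphism e = (\<lambda>i. tm_letter (e (i div 2)) ! (i mod 2))"

text \<open>Unlike the elements of \<^term>\<open>Gamma\<close>, the Thue-Morse sequence is indexed from 0.\<close>

definition thue_morse :: seq ("\<mm>") where
  "\<mm> = (THE e. e 0 = False \<and> tm_morphism e = e)"

lemma ex1_thue_morse: "\<exists>!e. e 0 = False \<and> tm_morphism e = e"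
proof -
  define t where "t = rec_nat (\<lambda>_::nat. False) (\<lambda>_ e. tm_morphism e)"
  have t_Suc: "t (Suc n) = tm_morphism (t n)" and t_0: "t 0 = (\<lambda>_. False)" for n
    by (simp_all add: t_def)
  have agree: "t (Suc n) i = t n i" if "i < 2 ^ n" for n i
    using that
  proof (induction n arbitrary: i)
    case 0
    then show ?case by (simp add: t_Suc t_0 tm_morphism_def)
  next
    case (Suc n)
    then have "i div 2 < 2 ^ n" by auto
    then have "t (Suc n) (i div 2) = t n (i div 2)" by (rule Suc.IH)
    then show ?case unfolding t_Suc[of "Suc n"] t_Suc[of n] tm_morphism_def
      by (simp add: t_Suc tm_morphism_def)
  qed
  have stable: "t (n + j) i = t n i" if "i < 2 ^ n" for n i j
  proof (induction j)
    case (Suc j)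
    have "(2::nat) ^ n \<le> 2 ^ (n + j)" by (rule power_increasing) simp_all
    with that have "i < 2 ^ (n + j)" by linarith
    from agree[OF this] Suc show ?case by simp
  qed simp
  define e where "e = (\<lambda>i. t i i)"
  have e_eq: "e i = t n i" if "i \<le> n" for i n
    using stable[of i i "n - i"] that by (simp add: e_def)
  have e_fix: "tm_morphism e i = e i" for i
  proof -
    have "e i = t (Suc i) i" by (rule e_eq) simp
    moreover have "e (i div 2) = t i (i div 2)" by (rule e_eq) simp
    ultimately show ?thesis by (simp add: t_Suc tm_morphism_def)
  qed
  show ?thesis
  proof (rule ex1I[of _ e])
    show "e 0 = False \<and> tm_morphism e = e" using e_fix by (auto simp: e_def t_0)
  next
    fix d :: seq assume d: "d 0 = False \<and> tm_morphism d = d"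
    have "d i = e i" for i
    proof (induction i rule: less_induct)
      case (less i)
      show ?case
      proof (cases "i = 0")
        case True
        then show ?thesis using d by (simp add: e_def t_0)
      next
        case False
        then have "d (i div 2) = e (i div 2)" by (intro less) simp
        then have "tm_morphism d i = tm_morphism e i" by (simp add: tm_morphism_def)
        then show ?thesis using d e_fix by simp
      qed
    qed
    then show "d = e" by auto
  qed
qed

definition word_pow :: "letter list \<Rightarrow> nat \<Rightarrow> letter list" where
  "word_pow w j = concat (replicate j w)"

text \<open>Only meaningful for nonempty words.\<close>

definition word_inf :: "letter list \<Rightarrow> seq" where
  "word_inf w = (\<lambda>i. w ! (i mod length w))"

text \<open>The words \<open>m_1 \<dots> m_j\<close> and \<open>m_1 \<dots> m_(j-1)\<close> followed by the mirror image of \<open>m_j\<close>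
  (the latter for \<open>j \<ge> 1\<close>).\<close>

definition tm_prefix :: "nat \<Rightarrow> letter list" where
  "tm_prefix j = map \<mm> [1..<Suc j]"

definition tm_prefix_flip :: "nat \<Rightarrow> letter list" where
  "tm_prefix_flip j = tm_prefix (j - 1) @ [\<not> \<mm> j]"

end

theory Submission
  imports Defs
begin

text \<open>
  Renormalization: the doubling \<open>e \<mapsto> 1 \<tau>(e)\<close>, where \<open>\<tau>\<close> is the Thue-Morse morphism, is strictly
  increasing, preserves \<^term>\<open>Gamma\<close>, and doubles smallest periods \<open>k \<ge> 2\<close> inside it. Conversely,
  every element of \<^term>\<open>Gamma\<close> up to \<open>1(10)\<^sup>\<infinity>\<close>, the doubling of \<open>1\<^sup>\<infinity>\<close>, is a doubling. Hence
  \<open>a_(2k)\<close> is the doubling of \<open>a_k\<close> for \<open>k \<ge> 2\<close>. A doubling with an odd period alternates, so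
  for odd \<open>k \<ge> 3\<close> the candidates lie above \<open>1(10)\<^sup>\<infinity>\<close>, and the least one repeats its prefix of
  length \<open>k\<close>. The Thue-Morse words appear because \<open>\<mm>\<^sub>1\<mm>\<^sub>2\<dots>\<close> is a fixed point of the doubling.
\<close>

section \<open>The lexicographic order on binary sequences\<close>

lemma lex_le_refl [simp]: "e \<preceq> e"
  by (simp add: lex_le_def)

lemma lex_le_antisym: "d \<preceq> e \<Longrightarrow> e \<preceq> d \<Longrightarrow> d = e"
  unfolding lex_le_def using less_fun_asym by blast

lemma lex_le_trans: "c \<preceq> d \<Longrightarrow> d \<preceq> e \<Longrightarrow> c \<preceq> e"
  unfolding lex_le_def using less_fun_trans by blast

lemma less_fun_bool_iff:
  "less_fun d e \<longleftrightarrow> (\<exists>k. \<not> d k \<and> e k \<and> (\<forall>j<k. d j = e j))" for d e :: seq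
  unfolding less_fun_def by auto

lemma not_lex_le_iff: "\<not> d \<preceq> e \<longleftrightarrow> less_fun e d"
proof -
  have "less_fun d e \<or> less_fun e d" if "d \<noteq> e"
  proof -
    define r where "r = (LEAST r. d r \<noteq> e r)"
    from that have "\<exists>r. d r \<noteq> e r" by (simp add: fun_eq_iff)
    then have "d r \<noteq> e r" unfolding r_def by (rule LeastI_ex)
    moreover have "d j = e j" if "j < r" for j
      using not_less_Least that unfolding r_def by blast
    ultimately show ?thesis unfolding less_fun_bool_iff by (cases "d r") blast+
  qed
  then show ?thesis
    unfolding lex_le_def using less_fun_asym less_fun_irrefl by blast
qed

lemma lex_le_top: "d \<preceq> (\<lambda>_. True)"
proof -
  have "\<not> less_fun (\<lambda>_. True) d" by (simp add: less_fun_bool_iff)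
  then show ?thesis using not_lex_le_iff by blast
qed

lemma less_fun_lex_le_trans: "less_fun c d \<Longrightarrow> d \<preceq> e \<Longrightarrow> less_fun c e"
  unfolding lex_le_def using less_fun_trans by blast

lemma lex_leI:
  fixes d e :: seq
  assumes "\<not> d k" "e k" "\<And>j. j < k \<Longrightarrow> d j = e j"
  shows "d \<preceq> e"
  unfolding lex_le_def less_fun_bool_iff using assms by blast

text \<open>Mirroring reverses the order. This turns the lower bound in \<open>Gamma\<close> into an
  upper bound on mirrored tails.\<close>

lemma mirror_lex_le_iff: "mirror d \<preceq> e \<longleftrightarrow> mirror e \<preceq> d"
proof -
  have "less_fun (mirror a) b \<Longrightarrow> less_fun (mirror b) a" for a b
    unfolding less_fun_bool_iff mirror_def by blast
  then show ?thesis
    unfolding lex_le_def by (auto simp: mirror_def)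
qed

section \<open>Shifts, periods and first consequences of membership in \<open>Gamma\<close>\<close>

lemma funpow_shift: "(shift ^^ k) e = (\<lambda>i. e (i + k))"
  by (induction k) (auto simp: shift_def)

lemma has_period_iff: "has_period p e \<longleftrightarrow> p \<ge> 1 \<and> (\<forall>i. e (i + p) = e i)"
  by (auto simp: has_period_def funpow_shift fun_eq_iff)

lemma has_period_mod:
  assumes "has_period p e"
  shows "e (i mod p) = e i"
proof -
  have "e (r + q * p) = e r" for r q
  proof (induction q)
    case (Suc q)
    have "e (r + q * p + p) = e (r + q * p)" using assms unfolding has_period_iff by blast
    with Suc show ?case by (simp add: ac_simps)
  qed simp
  from this[of "i mod p" "i div p"] show ?thesis by simp
qed

text \<open>Both letters \<open>b\<close> together give the upper bound on all tails of \<open>e\<close> and of its mirror image.\<close>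

lemma Gamma_iff: "e \<in> Gamma \<longleftrightarrow> (\<forall>b k. (\<lambda>i. e (i + k) = b) \<preceq> e)"
proof -
  have "(\<lambda>i. e (i + k) = True) = (shift ^^ k) e"
    and "(\<lambda>i. e (i + k) = False) = mirror ((shift ^^ k) e)" for k
    by (auto simp: funpow_shift mirror_def)
  moreover have "mirror e \<preceq> (shift ^^ k) e \<longleftrightarrow> mirror ((shift ^^ k) e) \<preceq> e" for k
    by (rule mirror_lex_le_iff)
  ultimately show ?thesis
    unfolding Gamma_def all_bool_eq by auto
qed

lemma GammaD: "e \<in> Gamma \<Longrightarrow> (\<lambda>i. e (i + k) = b) \<preceq> e"
  by (simp add: Gamma_iff)

lemma Gamma_0:
  assumes "e \<in> Gamma"
  shows "e 0"
proof (rule ccontr)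
  assume "\<not> e 0"
  then have "less_fun e (\<lambda>i. e (i + 0) = False)"
    unfolding less_fun_bool_iff by (intro exI[of _ 0]) auto
  with GammaD[OF assms, of 0 False] show False
    using not_lex_le_iff by blast
qed

text \<open>Here \<open>e\<close> begins with 10, so a repeated letter would start a tail that reads
  11, up to mirror image, and exceeds \<open>e\<close>.\<close>

lemma Gamma_alternating:
  assumes "e \<in> Gamma" "\<not> e 1"
  shows "e (Suc i) = (\<not> e i)"
proof (rule ccontr)
  assume "e (Suc i) \<noteq> (\<not> e i)"
  then have "less_fun e (\<lambda>j. e (j + i) = e i)"
    unfolding less_fun_bool_iff using assms Gamma_0[OF assms(1)]
    by (intro exI[of _ 1]) auto
  with GammaD[OF assms(1), of i "e i"] show False
    using not_lex_le_iff by blast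
qed

lemma alternating_has_period_2:
  assumes "\<And>i. e (Suc i) = (\<not> e i)"
  shows "has_period 2 e"
  by (simp add: has_period_iff assms)

text \<open>Before the first difference, \<open>e\<close> inherits the leading 1 from each position
  to the next. So \<open>1e\<close> still carries 1 at the difference and cannot be the smaller
  sequence.\<close>

lemma not_True_cons_less:
  fixes e :: seq
  shows "\<not> less_fun (case_nat True e) e"
proof
  assume "less_fun (case_nat True e) e"
  then obtain r where r: "\<not> case_nat True e r" "e r" "\<forall>j<r. case_nat True e j = e j"
    unfolding less_fun_bool_iff by blast
  have "j < r \<Longrightarrow> e j" for j
    using r(3) by (induction j) (metis nat.case(1), metis Suc_lessD nat.case(2))
  with r(1) show False by (cases r) auto
qed

text \<open>A period ending in 1 makes \<open>1e\<close> a tail of \<open>e\<close>. The bound in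
  \<open>Gamma\<close> then forces \<open>1e = e\<close>, hence a constant sequence of period
  1.\<close>

lemma least_period_last_letter:
  assumes "e \<in> Gamma" "smallest_period k e" "k \<ge> 2"
  shows "\<not> e (k - 1)"
proof
  assume last: "e (k - 1)"
  have per: "e (i + k) = e i" for i
    using assms(2) by (simp add: smallest_period_def has_period_iff)
  have "(\<lambda>i. e (i + (k - 1)) = True) = case_nat True e"
  proof
    fix i show "(e (i + (k - 1)) = True) = case_nat True e i"
      using last per[of "i - 1"] assms(3) by (cases i) auto
  qed
  with GammaD[OF assms(1), of "k - 1" True] not_True_cons_less[of e]
  have "case_nat True e = e" by (auto simp: lex_le_def)
  then have "e (Suc i) = e i" for i
    by (metis nat.case(2))
  then have "has_period 1 e" by (simp add: has_period_iff)
  with assms(2,3) show False by (fastforce simp: smallest_period_def)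
qed

section \<open>The doubling operator\<close>

definition doubling :: "seq \<Rightarrow> seq" where
  "doubling e = case_nat True (tm_morphism e)"

lemma doubling_0 [simp]: "doubling e 0"
  by (simp add: doubling_def)

lemma doubling_odd [simp]: "doubling e (Suc (2 * j)) = e j"
  by (cases "e j") (simp_all add: doubling_def tm_morphism_def)

lemma doubling_even [simp]: "doubling e (Suc (Suc (2 * j))) = (\<not> e j)"
  by (cases "e j") (simp_all add: doubling_def tm_morphism_def)

lemma nat_double_cases:
  obtains "i = 0" | j where "i = Suc (2 * j)" | j where "i = Suc (Suc (2 * j))"
proof (cases i)
  case (Suc l)
  then show ?thesis using that by (cases "even l") (auto elim!: evenE oddE)
qed

lemma doubling_eqI:
  assumes "e 0" "\<And>j. e (Suc (2 * j)) = c j" "\<And>j. e (Suc (Suc (2 * j))) = (\<not> c j)"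
  shows "e = doubling c"
proof
  fix i show "e i = doubling c i"
    by (cases i rule: nat_double_cases) (use assms in auto)
qed

lemma doubling_less:
  assumes "less_fun c e"
  shows "less_fun (doubling c) (doubling e)"
proof -
  from assms obtain k where k: "\<not> c k" "e k" "\<forall>j<k. c j = e j"
    unfolding less_fun_bool_iff by blast
  have "doubling c i = doubling e i" if "i < Suc (2 * k)" for i
    by (cases i rule: nat_double_cases) (use that k(3) in auto)
  then show ?thesis
    unfolding less_fun_bool_iff using k by (intro exI[of _ "Suc (2 * k)"]) auto
qed

lemma doubling_mono: "c \<preceq> e \<Longrightarrow> doubling c \<preceq> doubling e"
  unfolding lex_le_def using doubling_less by blast

text \<open>Position \<open>2 * k + 2\<close> carries the mirror of \<open>c k\<close>. Measured
  against \<open>b\<close> it reads 1 exactly when \<open>c k \<noteq> b\<close>, and then serves as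
  the leading 1 of a new doubling.\<close>

lemma doubling_tail:
  assumes "c k \<noteq> b"
  shows "(\<lambda>i. doubling c (i + 2 * Suc k) = b) = doubling (\<lambda>i. c (i + Suc k) = b)"
proof (rule doubling_eqI)
  show "doubling c (0 + 2 * Suc k) = b"
    using assms by simp
  show "(doubling c (Suc (2 * j) + 2 * Suc k) = b) = (c (j + Suc k) = b)" for j
    using doubling_odd[of c "j + Suc k"] by (simp add: algebra_simps)
  show "(doubling c (Suc (Suc (2 * j)) + 2 * Suc k) = b) = (\<not> (c (j + Suc k) = b))" for j
    using doubling_even[of c "j + Suc k"] by (cases b) (simp_all add: algebra_simps)
qed

text \<open>The doubling begins with 11. A tail from an odd position begins with 10 or 01; one from
  a positive even position begins with 0 or is the doubling of a tail of \<open>c\<close>, up to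
  mirror image.\<close>

lemma doubling_in_Gamma:
  assumes "c \<in> Gamma"
  shows "doubling c \<in> Gamma"
  unfolding Gamma_iff
proof (intro allI)
  fix b k
  let ?x = "\<lambda>i. doubling c (i + k) = b"
  have start: "?x \<preceq> doubling c" if "\<not> ?x 0"
    by (rule lex_leI[of _ 0]) (use that in auto)
  have one: "doubling c 1"
    using doubling_odd[of c 0] Gamma_0[OF assms] by simp
  show "?x \<preceq> doubling c"
  proof (cases k rule: nat_double_cases)
    case 1
    then show ?thesis using start by (cases b) auto
  next
    case (2 j)
    then have "?x 0 \<noteq> ?x 1" using doubling_even[of c j] doubling_odd[of c j] by auto
    then show ?thesis using start one
      by (cases "?x 0") (auto intro!: lex_leI[of _ 1])
  next
    case (3 j)
    show ?thesis
    proof (cases "c j = b")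
      case True
      then show ?thesis using start 3 by auto
    next
      case False
      then have "?x = doubling (\<lambda>i. c (i + Suc j) = b)"
        using doubling_tail[of c j b] 3 by simp
      then show ?thesis using doubling_mono GammaD[OF assms] by metis
    qed
  qed
qed

text \<open>Only tails preceded by the letter opposite to \<open>b\<close> are visible in the
  doubling; the others are reduced by induction to the tail starting one position earlier.\<close>

lemma Gamma_doublingD:
  assumes dbl: "doubling c \<in> Gamma" and "c 0"
  shows "c \<in> Gamma"
  unfolding Gamma_iff
proof (intro allI)
  fix b k
  show "(\<lambda>i. c (i + k) = b) \<preceq> c"
  proof (induction k)
    case 0
    then show ?case using \<open>c 0\<close> by (cases b) (auto intro!: lex_leI[of _ 0])
  next
    case (Suc k)
    let ?x = "\<lambda>i. c (i + Suc k) = b"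
    show ?case
    proof (rule ccontr)
      assume "\<not> ?x \<preceq> c"
      then have gt: "less_fun c ?x" by (simp add: not_lex_le_iff)
      show False
      proof (cases "c k = b")
        case True
        \<comment> \<open>The tail at \<open>k\<close> is 1 followed by the offending tail, so it
          exceeds \<open>1c\<close>, which is at least \<open>c\<close>.\<close>
        from gt obtain r where r: "\<not> c r" "?x r" "\<forall>j<r. c j = ?x j"
          unfolding less_fun_bool_iff by blast
        have "(\<lambda>i. c (i + k) = b) = case_nat True ?x"
          using True by (auto simp: fun_eq_iff split: nat.split)
        moreover have "less_fun (case_nat True c) (case_nat True ?x)"
          unfolding less_fun_bool_iff using r
          by (intro exI[of _ "Suc r"]) (auto split: nat.split)
        ultimately show False
          using Suc.IH less_fun_lex_le_trans not_True_cons_less by metis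
      next
        case False
        have "less_fun (doubling c) (\<lambda>i. doubling c (i + 2 * Suc k) = b)"
          using doubling_less[OF gt] doubling_tail[of c k b] False by simp
        then show False
          using GammaD[OF dbl] not_lex_le_iff by blast
      qed
    qed
  qed
qed

text \<open>
  Below \<open>1(10)\<^sup>\<infinity>\<close>, consider the first pair of positions \<open>2j, 2j + 1\<close> that carries equal
  letters. Reading backwards from it, alternating pairs end either at a factor exceeding
  \<open>1(10)\<^sup>\<infinity>\<close>, up to mirror image, or at the beginning of the sequence.
\<close>

lemma Gamma_below_imp_doubling:
  assumes d: "d \<in> Gamma" and le: "d \<preceq> doubling (\<lambda>_. True)"
  obtains c where "d = doubling c"
proof -
  have pairs: "d (Suc (Suc (2 * j))) = (\<not> d (Suc (2 * j)))" for j
  proof (cases "d 1")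
    case False
    then show ?thesis using Gamma_alternating[OF d] by simp
  next
    case True
    show ?thesis
    proof (induction j rule: less_induct)
      case (less j)
      show ?case
      proof (rule ccontr)
        assume eq: "d (Suc (Suc (2 * j))) \<noteq> (\<not> d (Suc (2 * j)))"
        \<comment> \<open>Letters are read relative to \<open>b\<close>, so that the first equal
          pair becomes 11 in \<open>x\<close>.\<close>
        define b where "b = d (Suc (2 * j))"
        define x where "x = (\<lambda>i. d i = b)"
        have xj: "x (Suc (2 * j))" "x (Suc (Suc (2 * j)))"
          using eq by (auto simp: x_def b_def)
        have xpair: "x (Suc (Suc (2 * l))) = (\<not> x (Suc (2 * l)))" if "l < j" for l
          using less[OF that] by (auto simp: x_def)
        have zero: "\<not> x (2 * i)" if "i \<le> j" for i
        proof
          assume "x (2 * i)"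
          with that obtain i where i: "i \<le> j" "x (2 * i)"
            and max: "\<And>l. l \<le> j \<Longrightarrow> x (2 * l) \<Longrightarrow> l \<le> i"
            using Nat.ex_has_greatest_nat[of "\<lambda>l. l \<le> j \<and> x (2 * l)" i j] by auto
          let ?y = "\<lambda>p. x (p + 2 * i)"
          have "less_fun (doubling (\<lambda>_. True)) ?y"
            unfolding less_fun_bool_iff
          \<comment> \<open>By maximality of \<open>i\<close>, from position \<open>2 * i\<close> on
            \<open>x\<close> reads 1, then pairs 10, then the pair 11. The second letter of that
            pair is where \<open>1(10)\<^sup>\<infinity>\<close> has 0.\<close>
          proof (intro exI[of _ "Suc (Suc (2 * (j - i)))"] conjI allI impI)
            show "\<not> doubling (\<lambda>_. True) (Suc (Suc (2 * (j - i))))" by simp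
            show "x (Suc (Suc (2 * (j - i))) + 2 * i)"
              using xj(2) i(1) by (simp add: diff_mult_distrib2)
            fix p assume p: "p < Suc (Suc (2 * (j - i)))"
            have even: "\<not> x (Suc (Suc (2 * (q + i))))" if "q + i < j" for q
              using max[of "Suc (q + i)"] that by auto
            show "doubling (\<lambda>_. True) p = x (p + 2 * i)"
            proof (cases p rule: nat_double_cases)
              case 1
              then show ?thesis using i by simp
            next
              case (2 q)
              then have "q + i \<le> j" using p i(1) by linarith
              then have "x (Suc (2 * (q + i)))"
                using xj(1) xpair[of "q + i"] even[of q] by (cases "q + i = j") auto
              then show ?thesis using 2 by (simp add: distrib_left)
            next
              case (3 q)
              then have "q + i < j" using p i(1) by linarith
              then show ?thesis using 3 even[of q] by (simp add: distrib_left)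
            qed
          qed
          moreover have "?y \<preceq> doubling (\<lambda>_. True)"
            using GammaD[OF d, of "2 * i" b] le by (auto simp: x_def intro: lex_le_trans)
          ultimately show False using not_lex_le_iff by blast
        qed
        \<comment> \<open>Now \<open>x\<close> begins with 01. Since \<open>d 0\<close> is 1, the
          letter \<open>b\<close> is 0, so \<open>d 1\<close> is 0 as well, against the case
          assumption.\<close>
        have "x 1"
          using xpair[of 0] zero[of 1] xj by (cases "j = 0") (auto simp: numeral_2_eq_2)
        with zero[of 0] True Gamma_0[OF d] show False
          by (auto simp: x_def)
      qed
    qed
  qed
  have "d = doubling (\<lambda>j. d (Suc (2 * j)))"
    by (rule doubling_eqI) (use pairs Gamma_0[OF d] in auto)
  then show ?thesis by (rule that)
qed

section \<open>Periods of doublings and the reduction of even periods\<close>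

text \<open>In every doubling, the letter at an odd position is followed by its mirror. An odd
  period carries this over to even positions.\<close>

lemma doubling_odd_period:
  assumes "has_period p (doubling c)" "odd p"
  shows "doubling c (Suc i) = (\<not> doubling c i)"
proof -
  have odd: "doubling c (Suc i) = (\<not> doubling c i)" if "odd i" for i
    using that by (auto elim!: oddE)
  show ?thesis
  proof (cases "odd i")
    case False
    then have "doubling c (Suc (i + p)) = (\<not> doubling c (i + p))"
      using assms(2) by (intro odd) simp
    moreover have "doubling c (i + p) = doubling c i" "doubling c (Suc i + p) = doubling c (Suc i)"
      using assms(1) unfolding has_period_iff by blast+
    ultimately show ?thesis by simp
  qed (rule odd)
qed

text \<open>The leading 1 must recur at position \<open>2 * k\<close>, which carries the mirror of
  \<open>c (k - 1)\<close>.\<close>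

lemma doubling_has_period:
  assumes "has_period k c" "\<not> c (k - 1)"
  shows "has_period (2 * k) (doubling c)"
  unfolding has_period_iff
proof (intro conjI allI)
  have k: "k \<ge> 1" and per: "\<And>i. c (i + k) = c i"
    using assms(1) by (auto simp: has_period_iff)
  show "1 \<le> 2 * k" using k by simp
  fix i
  show "doubling c (i + 2 * k) = doubling c i"
  proof (cases i rule: nat_double_cases)
    case 1
    moreover have "2 * k = Suc (Suc (2 * (k - 1)))" using k by simp
    ultimately show ?thesis using doubling_even[of c "k - 1"] assms(2) by simp
  next
    case (2 j)
    then show ?thesis using doubling_odd[of c "j + k"] per[of j] by (simp add: distrib_left)
  next
    case (3 j)
    then show ?thesis using doubling_even[of c "j + k"] per[of j] by (simp add: distrib_left)
  qed
qed

lemma has_period_doublingD: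
  assumes "has_period (2 * k) (doubling c)"
  shows "has_period k c"
  unfolding has_period_iff
proof (intro conjI allI)
  show "1 \<le> k" using assms by (auto simp: has_period_iff)
  fix i
  have "doubling c (Suc (2 * i) + 2 * k) = doubling c (Suc (2 * i))"
    using assms unfolding has_period_iff by blast
  then show "c (i + k) = c i"
    using doubling_odd[of c "i + k"] by (simp add: distrib_left)
qed

lemma smallest_period_doubling:
  assumes "smallest_period k c" "\<not> c (k - 1)" "c 0"
  shows "smallest_period (2 * k) (doubling c)"
  unfolding smallest_period_def
proof (intro conjI allI impI)
  show "has_period (2 * k) (doubling c)"
    using assms by (intro doubling_has_period) (auto simp: smallest_period_def)
  fix q assume q: "has_period q (doubling c)"
  have "even q"
  proof (rule ccontr)
    assume "odd q"
    \<comment> \<open>An odd period would force alternation, but the doubling begins with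
      11.\<close>
    from doubling_odd_period[OF q this, of 0] show False
      using \<open>c 0\<close> doubling_odd[of c 0] by simp
  qed
  then obtain r where "q = 2 * r" by (elim evenE)
  with q has_period_doublingD assms(1) show "2 * k \<le> q"
    by (auto simp: smallest_period_def)
qed

lemma smallest_period_doublingD:
  assumes "smallest_period (2 * k) (doubling c)"
  shows "smallest_period k c"
  unfolding smallest_period_def
proof (intro conjI allI impI)
  have per: "has_period (2 * k) (doubling c)"
    using assms by (simp add: smallest_period_def)
  then show k: "has_period k c" by (rule has_period_doublingD)
  then have "k \<ge> 1" by (simp add: has_period_iff)
  have "doubling c (0 + 2 * k) = doubling c 0"
    using per unfolding has_period_iff by blast
  moreover have "2 * k = Suc (Suc (2 * (k - 1)))" using \<open>k \<ge> 1\<close> by simp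
  ultimately have last: "\<not> c (k - 1)"
    using doubling_even[of c "k - 1"] by simp
  fix q assume q: "has_period q c"
  \<comment> \<open>Position \<open>k * q - 1\<close> ends both a block of length \<open>k\<close>
    and a block of length \<open>q\<close>, so the last letters of the two periods agree.\<close>
  have "\<not> c (q - 1)"
  proof -
    have "q \<ge> 1" using q by (simp add: has_period_iff)
    have "c (k - 1 + (q - 1) * k) = c (k - 1)"
      using has_period_mod[OF k, of "k - 1 + (q - 1) * k"] has_period_mod[OF k, of "k - 1"] by simp
    moreover have "c (q - 1 + (k - 1) * q) = c (q - 1)"
      using has_period_mod[OF q, of "q - 1 + (k - 1) * q"] has_period_mod[OF q, of "q - 1"] by simp
    moreover have "k - 1 + (q - 1) * k = q - 1 + (k - 1) * q"
      using \<open>k \<ge> 1\<close> \<open>q \<ge> 1\<close> by (cases k; cases q) (auto simp: algebra_simps)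
    ultimately show ?thesis using last by simp
  qed
  with doubling_has_period[OF q] assms show "k \<le> q"
    by (auto simp: smallest_period_def)
qed

text \<open>Competitors up to \<open>1(10)\<^sup>\<infinity>\<close> are doublings of competitors of
  \<open>e\<close>, so monotonicity decides. All others exceed every doubling, because
  \<open>1\<^sup>\<infinity>\<close> is the greatest sequence.\<close>

lemma is_least_periodic_doubling:
  assumes e: "is_least_periodic k e" and "k \<ge> 2"
  shows "is_least_periodic (2 * k) (doubling e)"
  unfolding is_least_periodic_def
proof (intro conjI ballI impI)
  have eG: "e \<in> Gamma" and ek: "smallest_period k e"
    and least: "\<And>d. d \<in> Gamma \<Longrightarrow> smallest_period k d \<Longrightarrow> e \<preceq> d"
    using e by (auto simp: is_least_periodic_def)
  show "doubling e \<in> Gamma" using eG by (rule doubling_in_Gamma)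
  show "smallest_period (2 * k) (doubling e)"
    using smallest_period_doubling[OF ek least_period_last_letter[OF eG ek \<open>k \<ge> 2\<close>] Gamma_0[OF eG]] .
  fix d assume d: "d \<in> Gamma" "smallest_period (2 * k) d"
  show "doubling e \<preceq> d"
  proof (cases "d \<preceq> doubling (\<lambda>_. True)")
    case True
    with d(1) obtain c where c: "d = doubling c" by (rule Gamma_below_imp_doubling)
    \<comment> \<open>Otherwise \<open>d\<close> alternates and has period 2, which is less than
      \<open>2 * k\<close>. The letter \<open>d 1\<close> is the first letter of
      \<open>c\<close>.\<close>
    have "d 1"
    proof (rule ccontr)
      assume "\<not> d 1"
      then have "has_period 2 d"
        using Gamma_alternating[OF d(1)] alternating_has_period_2 by blast
      with d(2) \<open>k \<ge> 2\<close> show False by (fastforce simp: smallest_period_def)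
    qed
    then have "c 0" using c doubling_odd[of c 0] by simp
    then have "c \<in> Gamma" using d(1) c Gamma_doublingD by blast
    moreover have "smallest_period k c" using d(2) c smallest_period_doublingD by blast
    ultimately show ?thesis using least c doubling_mono by blast
  next
    case False
    have "doubling e \<preceq> doubling (\<lambda>_. True)"
      by (intro doubling_mono lex_le_top)
    moreover have "doubling (\<lambda>_. True) \<preceq> d"
      using False not_lex_le_iff by (auto simp: lex_le_def)
    ultimately show ?thesis by (rule lex_le_trans)
  qed
qed

section \<open>Periods one, two and odd\<close>

lemma word_inf_has_period: "w \<noteq> [] \<Longrightarrow> has_period (length w) (word_inf w)"
  by (simp add: has_period_iff word_inf_def Suc_leI)

lemma word_inf_eqI:
  assumes "has_period (length w) e" "\<And>i. i < length w \<Longrightarrow> e i = w ! i"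
  shows "e = word_inf w"
proof
  fix i
  have "length w > 0" using assms(1) by (auto simp: has_period_iff)
  then have "e (i mod length w) = w ! (i mod length w)"
    by (intro assms(2) mod_less_divisor)
  then show "e i = word_inf w i"
    using has_period_mod[OF assms(1), of i] by (simp add: word_inf_def)
qed

lemma is_least_periodic_1: "is_least_periodic 1 (word_inf [True])"
proof -
  have eq: "word_inf [True] = (\<lambda>_. True)" by (simp add: word_inf_def fun_eq_iff)
  have "d = (\<lambda>_. True)" if "d \<in> Gamma" "smallest_period 1 d" for d
  proof
    fix i
    have "d (i mod 1) = d i"
      using that(2) by (intro has_period_mod) (simp add: smallest_period_def)
    then show "d i = True" using Gamma_0[OF that(1)] by simp
  qed
  then show ?thesis
    unfolding is_least_periodic_def eq
    by (auto simp: Gamma_iff lex_le_top smallest_period_def has_period_iff)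
qed

lemma is_least_periodic_2: "is_least_periodic 2 (word_inf [True, False])"
proof -
  let ?e = "word_inf [True, False]"
  have e: "?e i = even i" for i
    by (cases "even i") (auto simp: word_inf_def numeral_2_eq_2[symmetric] odd_iff_mod_2_eq_one)
  have "?e \<in> Gamma"
    unfolding Gamma_iff
  proof (intro allI)
    fix b k
    show "(\<lambda>i. ?e (i + k) = b) \<preceq> ?e"
    proof (cases "even k = b")
      case True
      then have "(\<lambda>i. ?e (i + k) = b) = ?e" by (auto simp: e)
      then show ?thesis by simp
    next
      case False
      then show ?thesis by (intro lex_leI[of _ 0]) (auto simp: e)
    qed
  qed
  moreover have "smallest_period 2 ?e"
    unfolding smallest_period_def
  proof (intro conjI allI impI)
    show "has_period 2 ?e" by (simp add: has_period_iff e)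
    fix q assume "has_period q ?e"
    then have "q \<ge> 1" "even (0 + q) = even (0::nat)" unfolding has_period_iff e by blast+
    then show "2 \<le> q" by (cases "q = 1") auto
  qed
  moreover have "?e \<preceq> d" if "d \<in> Gamma" "smallest_period 2 d" for d
  proof -
    have "\<not> d (2 - 1)" using least_period_last_letter[OF that] by simp
    moreover have "has_period 2 d" using that(2) by (simp add: smallest_period_def)
    ultimately have "d = ?e"
      using Gamma_0[OF that(1)] by (intro word_inf_eqI) (auto simp: numeral_2_eq_2 less_Suc_eq)
    then show ?thesis by simp
  qed
  ultimately show ?thesis by (simp add: is_least_periodic_def)
qed

lemma length_word_pow [simp]: "length (word_pow w j) = j * length w"
  by (induction j) (auto simp: word_pow_def)

lemma nth_word_pow_10: "i < 2 * m \<Longrightarrow> word_pow [True, False] m ! i = even i"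
proof (induction m arbitrary: i)
  case (Suc m)
  have "word_pow [True, False] (Suc m) = True # False # word_pow [True, False] m"
    by (simp add: word_pow_def)
  with Suc show ?case
    by (auto simp: nth_Cons split: nat.split)
qed simp

text \<open>The word is the prefix of \<open>1(10)\<^sup>\<infinity>\<close> of length
  \<open>k\<close>. Every competitor lies above \<open>1(10)\<^sup>\<infinity>\<close>: it exceeds
  the candidate if it first differs within this prefix, and otherwise has the same period
  word.\<close>

lemma is_least_periodic_odd:
  assumes "m \<ge> 1"
  shows "is_least_periodic (2 * m + 1) (word_inf (True # word_pow [True, False] m))"
proof -
  define w where "w = True # word_pow [True, False] m"
  define k where "k = 2 * m + 1"
  have len: "length w = k" and k: "k \<ge> 3" "odd k" using assms by (auto simp: w_def k_def)
  have nth: "w ! i = (i = 0 \<or> odd i)" if "i < k" for i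
    using that by (cases i) (auto simp: w_def k_def nth_word_pow_10)
  let ?e = "word_inf w"
  have per: "has_period k ?e"
    using word_inf_has_period[of w] len k by (auto simp: w_def)
  have e: "?e i = (i = 0 \<or> odd i)" if "i < k" for i
    using that nth by (simp add: word_inf_def len)
  have e01: "?e 0" "?e 1" using e k by auto
  have "?e (0 + k) = ?e 0" using per unfolding has_period_iff by blast
  then have ek: "?e k" using e01 by simp
  have "?e \<in> Gamma"
    unfolding Gamma_iff
  proof (intro allI)
    fix b l
    define r where "r = l mod k"
    have r: "r < k" using k by (simp add: r_def)
    have "?e (i + l) = ?e (i + r)" for i
      using has_period_mod[OF per, of "i + l"] has_period_mod[OF per, of "i + r"]
      by (simp add: r_def mod_add_right_eq)
    then have eq: "(\<lambda>i. ?e (i + l) = b) = (\<lambda>i. ?e (i + r) = b)" by simp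
    \<comment> \<open>Within one period, including the step into the next, equal neighbours occur
      only at positions 0 and 1. So every other tail begins with 10 or 01 and loses to 11.\<close>
    have alt: "?e (Suc r) = (\<not> ?e r)" if "r \<noteq> 0"
    proof (cases "Suc r = k")
      case True
      then show ?thesis using e[OF r] ek k that by (metis even_Suc)
    next
      case False
      then show ?thesis using e[of "Suc r"] e[OF r] r that by simp
    qed
    show "(\<lambda>i. ?e (i + l) = b) \<preceq> ?e"
      unfolding eq
    proof (cases "?e r = b")
      case False
      then show "(\<lambda>i. ?e (i + r) = b) \<preceq> ?e" using e01 by (intro lex_leI[of _ 0]) auto
    next
      case True
      show "(\<lambda>i. ?e (i + r) = b) \<preceq> ?e"
      proof (cases "r = 0")
        case True
        with \<open>?e r = b\<close> e01 show ?thesis by simp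
      next
        case False
        then show ?thesis using alt True e01 by (intro lex_leI[of _ 1]) auto
      qed
    qed
  qed
  moreover have "smallest_period k ?e"
    unfolding smallest_period_def
  proof (intro conjI allI impI)
    show "has_period k ?e" by (rule per)
    fix q assume q: "has_period q ?e"
    show "k \<le> q"
    proof (rule ccontr)
      assume "\<not> k \<le> q"
      have "q \<ge> 1" "?e (0 + q) = ?e 0" "?e (1 + q) = ?e 1"
        using q unfolding has_period_iff by blast+
      \<comment> \<open>A shorter period would repeat the initial 11 at \<open>q\<close>. Then
        \<open>q\<close> is odd, and \<open>Suc q\<close> is even and still below the odd number
        \<open>k\<close>, where the letter is 0.\<close>
      with e01 have "?e q" "?e (Suc q)" "q \<ge> 1" by auto
      with e[of q] \<open>\<not> k \<le> q\<close> have "odd q" by simp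
      moreover from this have "Suc q < k"
        using \<open>\<not> k \<le> q\<close> k(2) by (metis Suc_lessI even_Suc not_le)
      ultimately show False using e[of "Suc q"] \<open>?e (Suc q)\<close> by simp
    qed
  qed
  moreover have "?e \<preceq> d" if d: "d \<in> Gamma" "smallest_period k d" for d
  proof -
    have dper: "has_period k d" using d(2) by (simp add: smallest_period_def)
    have "\<not> d \<preceq> doubling (\<lambda>_. True)"
    proof
      assume "d \<preceq> doubling (\<lambda>_. True)"
      with d(1) obtain c where c: "d = doubling c" by (rule Gamma_below_imp_doubling)
      with dper k(2) doubling_odd_period have "has_period 2 d"
        by (intro alternating_has_period_2) blast
      with d(2) k(1) show False by (fastforce simp: smallest_period_def)
    qed
    then obtain r where r: "\<not> doubling (\<lambda>_. True) r" "d r"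
      "\<forall>j<r. doubling (\<lambda>_. True) j = d j"
      unfolding not_lex_le_iff less_fun_bool_iff by blast
    have agree: "doubling (\<lambda>_. True) i = ?e i" if "i < k" for i
      using e[OF that] by (cases i rule: nat_double_cases) auto
    show ?thesis
    proof (cases "r < k")
      case True
      then show ?thesis using r agree by (intro lex_leI[of _ r]) auto
    next
      case False
      then have "d = ?e"
        using r agree e nth dper by (intro word_inf_eqI) (auto simp: len)
      then show ?thesis by simp
    qed
  qed
  ultimately show ?thesis by (simp add: is_least_periodic_def w_def k_def)
qed

section \<open>Thue-Morse words\<close>

lemma thue_morse_props: "\<mm> 0 = False" "tm_morphism \<mm> = \<mm>"
  using theI'[OF ex1_thue_morse] by (auto simp: thue_morse_def)

lemma thue_morse_even: "\<mm> (2 * j) = \<mm> j"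
proof -
  have "tm_morphism \<mm> (2 * j) = \<mm> j" by (cases "\<mm> j") (auto simp: tm_morphism_def)
  then show ?thesis by (simp add: thue_morse_props)
qed

lemma thue_morse_odd: "\<mm> (Suc (2 * j)) = (\<not> \<mm> j)"
proof -
  have "tm_morphism \<mm> (Suc (2 * j)) = (\<not> \<mm> j)" by (cases "\<mm> j") (auto simp: tm_morphism_def)
  then show ?thesis by (simp add: thue_morse_props)
qed

lemma thue_morse_1: "\<mm> (Suc 0)"
  using thue_morse_odd[of 0] by (simp add: thue_morse_props)

lemma thue_morse_mult_power2: "\<mm> (j * 2 ^ n) = \<mm> j"
proof (induction n)
  case (Suc n)
  then show ?case using thue_morse_even[of "j * 2 ^ n"] by (simp add: algebra_simps)
qed simp

lemma thue_morse_2_3: "\<mm> 2" "\<not> \<mm> 3"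
  using thue_morse_even[of 1] thue_morse_odd[of 1] thue_morse_1 by (auto simp: numeral_eq_Suc)

text \<open>
  For a word ending in 0, the image under the morphism ends in 1, and moving that 1 to the front
  gives the word whose infinite power is the doubling.
\<close>

definition doubles :: "letter list \<Rightarrow> letter list \<Rightarrow> bool" where
  "doubles w v \<longleftrightarrow> True # concat (map tm_letter w) = v @ [True]"

text \<open>The trailing 1 left over by the first word serves as the leading 1 of the
  second.\<close>

lemma doubles_append: "doubles w v \<Longrightarrow> doubles w' v' \<Longrightarrow> doubles (w @ w') (v @ v')"
  unfolding doubles_def by (metis append_Cons append_Nil append_assoc concat_append map_append)

lemma doubles_word_pow: "doubles w v \<Longrightarrow> doubles (word_pow w j) (word_pow v j)"
proof (induction j)
  case 0
  then show ?case by (simp add: doubles_def word_pow_def)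
next
  case (Suc j)
  then show ?case using doubles_append[of w v] by (simp add: word_pow_def)
qed

lemma concat_tm_letter:
  "length (concat (map tm_letter w)) = 2 * length w"
  "j < length w \<Longrightarrow> concat (map tm_letter w) ! (2 * j) = w ! j"
  "j < length w \<Longrightarrow> concat (map tm_letter w) ! Suc (2 * j) = (\<not> w ! j)"
proof -
  have t: "tm_letter x = [x, \<not> x]" for x by (cases x) auto
  show "length (concat (map tm_letter w)) = 2 * length w"
    by (induction w) (auto simp: t)
  show "concat (map tm_letter w) ! (2 * j) = w ! j" if "j < length w"
    using that by (induction w arbitrary: j) (auto simp: t nth_Cons split: nat.split)
  show "concat (map tm_letter w) ! Suc (2 * j) = (\<not> w ! j)" if "j < length w"
    using that by (induction w arbitrary: j) (auto simp: t nth_Cons split: nat.split)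
qed

lemma doubling_word_inf:
  assumes "doubles w v" "w \<noteq> []"
  shows "doubling (word_inf w) = word_inf v"
proof (rule word_inf_eqI)
  let ?k = "length w"
  have k: "?k \<ge> 1" using assms(2) by (simp add: Suc_leI)
  have eq: "True # concat (map tm_letter w) = v @ [True]"
    using assms(1) by (simp add: doubles_def)
  have len: "length v = 2 * ?k"
    using arg_cong[OF eq, of length] by (simp add: concat_tm_letter(1))
  have nth: "(True # concat (map tm_letter w)) ! i = v ! i" if "i < 2 * ?k" for i
    using that len by (simp add: eq nth_append)
  \<comment> \<open>The trailing 1 is the mirror of the last letter of \<open>w\<close>; so
    \<open>w\<close> ends in 0, as \<open>doubling_has_period\<close> requires.\<close>
  have "(True # concat (map tm_letter w)) ! (2 * ?k)"
    using len by (simp add: eq nth_append)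
  then have "concat (map tm_letter w) ! Suc (2 * (?k - 1))"
    using k by (cases "length w") auto
  then have "\<not> w ! (?k - 1)" using concat_tm_letter(3)[of "?k - 1" w] k by simp
  then have "\<not> word_inf w (?k - 1)" using k by (simp add: word_inf_def)
  then show "has_period (length v) (doubling (word_inf w))"
    unfolding len using word_inf_has_period[OF assms(2)] by (rule doubling_has_period[rotated])
  fix i assume i: "i < length v"
  show "doubling (word_inf w) i = v ! i"
  proof (cases i rule: nat_double_cases)
    case 1
    then show ?thesis using nth[of 0] assms(2) by simp
  next
    case (2 j)
    then show ?thesis using nth[of i] i concat_tm_letter(2)[of j w] by (simp add: len word_inf_def)
  next
    case (3 j)
    then show ?thesis using nth[of i] i concat_tm_letter(3)[of j w] by (simp add: len word_inf_def)
  qed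
qed

text \<open>The image of \<open>\<mm> i\<close> is \<open>\<mm> (2 * i)\<close> followed by
  \<open>\<mm> (2 * i + 1)\<close>, and the prepended 1 is \<open>\<mm> 1\<close>.\<close>

lemma concat_tm_prefix: "True # concat (map tm_letter (tm_prefix j)) = tm_prefix (Suc (2 * j))"
proof (induction j)
  case 0
  then show ?case by (simp add: tm_prefix_def thue_morse_1)
next
  case (Suc j)
  have "tm_prefix (Suc j) = tm_prefix j @ [\<mm> (Suc j)]" for j by (simp add: tm_prefix_def)
  moreover have "tm_letter x = [x, \<not> x]" for x by (cases x) auto
  ultimately show ?case
    using Suc thue_morse_even[of "Suc j"] thue_morse_odd[of "Suc j"] by simp
qed

lemma doubles_tm_prefix:
  assumes "\<not> \<mm> j"
  shows "doubles (tm_prefix j) (tm_prefix (2 * j))"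
  using assms thue_morse_odd[of j] by (simp add: doubles_def concat_tm_prefix) (simp add: tm_prefix_def)

text \<open>The flipped last letter is 0, with image 01: its 0 is the mirror of
  \<open>\<mm> (2 * j)\<close>, and its 1 is the trailing letter.\<close>

lemma doubles_tm_prefix_flip:
  assumes "\<mm> j" "j \<ge> 1"
  shows "doubles (tm_prefix_flip j) (tm_prefix_flip (2 * j))"
proof -
  have "True # concat (map tm_letter (tm_prefix (j - 1))) = tm_prefix (2 * j - 1)"
    using assms(2) by (simp add: concat_tm_prefix) (cases j; simp)
  then show ?thesis
    using assms by (simp add: doubles_def tm_prefix_flip_def thue_morse_even)
qed

section \<open>The formula by repeated doubling\<close>

text \<open>The induction starts at period 2, since the doubling of
  \<open>1\<^sup>\<infinity>\<close> is not purely periodic.\<close>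

lemma is_least_periodic_power2:
  "is_least_periodic (2 ^ Suc n) (word_inf (tm_prefix_flip (2 ^ Suc n)))"
proof (induction n)
  case 0
  have "tm_prefix_flip 2 = [True, False]"
    using thue_morse_1 thue_morse_2_3 by (simp add: tm_prefix_flip_def tm_prefix_def)
  then show ?case using is_least_periodic_2 by simp
next
  case (Suc n)
  have "doubles (tm_prefix_flip (2 ^ Suc n)) (tm_prefix_flip (2 * 2 ^ Suc n))"
    using thue_morse_mult_power2[of 1 "Suc n"] thue_morse_1 by (intro doubles_tm_prefix_flip) auto
  then have "doubling (word_inf (tm_prefix_flip (2 ^ Suc n))) = word_inf (tm_prefix_flip (2 ^ Suc (Suc n)))"
    using doubling_word_inf by (simp add: tm_prefix_flip_def)
  moreover have "(2::nat) \<le> 2 ^ Suc n" by simp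
  ultimately show ?case using is_least_periodic_doubling[OF Suc] by simp
qed

lemma is_least_periodic_odd_multiple:
  assumes "m \<ge> 1"
  shows "is_least_periodic (2 ^ n * (2 * m + 1))
    (word_inf (tm_prefix (3 * 2 ^ n) @ word_pow (tm_prefix_flip (2 ^ (n + 1))) (m - 1)))"
proof (induction n)
  case 0
  have "tm_prefix_flip 2 = [True, False]"
    using thue_morse_1 thue_morse_2_3 by (simp add: tm_prefix_flip_def tm_prefix_def)
  moreover have "tm_prefix 3 = [True, True, False]"
    using thue_morse_1 thue_morse_2_3
    by (simp add: tm_prefix_def upt_rec numeral_2_eq_2 numeral_3_eq_3)
  \<comment> \<open>Splitting off one block 10 lets the leading 1 complete the word 110, which is
    \<open>tm_prefix 3\<close>.\<close>
  moreover have "word_pow [True, False] m = [True, False] @ word_pow [True, False] (m - 1)"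
    using assms by (cases m) (auto simp: word_pow_def)
  ultimately show ?case using is_least_periodic_odd[OF assms] by simp
next
  case (Suc n)
  let ?w = "tm_prefix (3 * 2 ^ n) @ word_pow (tm_prefix_flip (2 ^ (n + 1))) (m - 1)"
  let ?v = "tm_prefix (2 * (3 * 2 ^ n)) @ word_pow (tm_prefix_flip (2 * 2 ^ (n + 1))) (m - 1)"
  have "doubles ?w ?v"
    \<comment> \<open>The doubled words need \<open>\<mm> (3 * 2 ^ n) = \<mm> 3 = 0\<close> and
      \<open>\<mm> (2 ^ (n + 1)) = \<mm> 1 = 1\<close>.\<close>
    using thue_morse_mult_power2[of 1 "n + 1"] thue_morse_mult_power2[of 3 n]
      thue_morse_1 thue_morse_2_3
    by (intro doubles_append doubles_word_pow doubles_tm_prefix doubles_tm_prefix_flip) auto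
  moreover have "?w \<noteq> []" by (simp add: tm_prefix_def)
  ultimately have "doubling (word_inf ?w) = word_inf ?v" by (rule doubling_word_inf)
  moreover have "2 \<le> 2 ^ n * (2 * m + 1)"
    using assms mult_le_mono[of 1 "2 ^ n" 2 "2 * m + 1"] by simp
  ultimately have "is_least_periodic (2 * (2 ^ n * (2 * m + 1))) (word_inf ?v)"
    using is_least_periodic_doubling[OF Suc] by simp
  moreover have "2 * (2 ^ n * (2 * m + 1)) = 2 ^ Suc n * (2 * m + 1)"
    and "2 * (3 * 2 ^ n) = (3 * 2 ^ Suc n :: nat)"
    and "2 * 2 ^ (n + 1) = (2 ^ (Suc n + 1) :: nat)" by simp_all
  ultimately show ?case by (simp only:)
qed

lemma a_seq_eq:
  assumes "is_least_periodic k e"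
  shows "a_seq k = e"
  unfolding a_seq_def
proof (rule the_equality)
  fix d assume "is_least_periodic k d"
  with assms show "d = e" unfolding is_least_periodic_def by (blast intro: lex_le_antisym)
qed (rule assms)

theorem proposition2p16:
  fixes k n m :: nat
  assumes "k \<ge> 1" and "k = 2 ^ n * (2 * m + 1)"
  shows "is_least_periodic k (a_seq k) \<and>
    a_seq k = (if m = 0 \<and> n = 0 then word_inf [\<mm> 1]
           else if m = 0 then word_inf (tm_prefix_flip (2 ^ n))
           else word_inf (tm_prefix (3 * 2 ^ n)
                  @ word_pow (tm_prefix_flip (2 ^ (n + 1))) (m - 1)))"
    (is "_ \<and> _ = ?e")
proof -
  have "is_least_periodic k ?e"
  proof (cases "m = 0")
    case True
    then show ?thesis
      using assms is_least_periodic_1 is_least_periodic_power2[of "n - 1"] thue_morse_1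
      by (cases n) auto
  next
    case False
    then show ?thesis using assms is_least_periodic_odd_multiple[of m n] by simp
  qed
  moreover from this have "a_seq k = ?e" by (rule a_seq_eq)
  ultimately show ?thesis by simp
qed

end
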